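(* Let $f=c_dt^d+\cdots+c_0\in\mathbb{Z}[t]$ be an irreducible polynomial of degree $d$ whose coefficients do not all share a common factor. If some prime $p$ divides $c_d$ exactly once or divides $c_0$ exactly once, then $f$ is strongly irreducible.
   Context: A polynomial $f\in\mathbb{Q}[t]$ is strongly irreducible if $f(t^k)$ is irreducible in $\mathbb{Q}[t]$ for every positive integer $k$. A prime $p$ divides an integer $c$ exactly once if $p\mid c$ and $p^2\nmid c$. *)

theory Defs
  imports "HOL-Computational_Algebra.Computational_Algebra"
begin

definition strongly_irreducible :: "rat poly \<Rightarrow> bool" where
  "strongly_irreducible f \<longleftrightarrow> (\<forall>k::nat. k > 0 \<longrightarrow> irreducible (pcompose f (monom 1 k)))"

definition divides_exactly_once :: "int \<Rightarrow> int \<Rightarrow> bool" where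
  "divides_exactly_once p c \<longleftrightarrow> p dvd c \<and> \<not> p\<^sup>2 dvd c"

end

(* View Z[t] as a free module of rank k over Z[s], s = t^k, and let N : Z[t] -> Z[s] be its norm, so
   that N(f(t^k)) = f^k, the constant term of N(g) is g(0)^k, and g divides N(g)(t^k).  Suppose that
   p divides f(0) exactly once and f(t^k) = g h.  Then p does not divide one of g(0), h(0), say h(0).
   Now N(g) N(h) = f^k with f prime, and f does not divide N(h), because otherwise p would divide
   h(0)^k.  Hence N(h) is a unit, and so is its divisor h.  The case of the leading coefficient
   follows by reversing f, and Gauss's lemma translates between Z and Q. *)
theory Submission
  imports Defs
    "Jordan_Normal_Form.Determinant"
    "Berlekamp_Zassenhaus.Square_Free_Int_To_Square_Free_GFp"
begin

hide_const (open) up_ring.coeff up_ring.monom Module.smult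

section \<open>The substitution of t^k for t, and reversal of coefficients\<close>

lemma coeff_pcompose_monom:
  fixes f :: "'a::comm_semiring_1 poly"
  assumes "k > 0"
  shows "coeff (pcompose f (monom 1 k)) n = (if k dvd n then coeff f (n div k) else 0)"
  using assms
proof (induction f arbitrary: n)
  case 0
  then show ?case by simp
next
  case (pCons a f)
  show ?case
  proof (cases "n < k")
    case True
    then show ?thesis
      using pCons.prems by (auto simp: pcompose_pCons coeff_monom_mult coeff_pCons split: nat.splits)
  next
    case False
    then have "k dvd n - k \<longleftrightarrow> k dvd n" "n div k = Suc ((n - k) div k)" "n > 0"
      using pCons.prems by (auto simp: le_div_geq dvd_minus_self)
    then show ?thesis
      using False pCons by (auto simp: pcompose_pCons coeff_monom_mult coeff_pCons split: nat.splits)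
  qed
qed

lemma reflect_poly_pcompose_monom:
  fixes f :: "'a::{comm_semiring_1,semiring_no_zero_divisors} poly"
  assumes "k > 0"
  shows "reflect_poly (pcompose f (monom 1 k)) = pcompose (reflect_poly f) (monom 1 k)"
proof (rule poly_eqI)
  fix n
  show "coeff (reflect_poly (pcompose f (monom 1 k))) n = coeff (pcompose (reflect_poly f) (monom 1 k)) n"
  proof (cases "k dvd n")
    case True
    then obtain m where "n = m * k" by (metis dvd_def mult.commute)
    then show ?thesis
      using assms by (simp add: coeff_reflect_poly degree_monom_eq coeff_pcompose_monom flip: diff_mult_distrib)
  next
    case False
    \<comment> \<open>Subtraction on naturals truncates to 0, which k divides; hence the bound on
      n.\<close>
    have "\<not> k dvd degree f * k - n" if "n \<le> degree f * k"
      using that False by (metis dvd_diffD1 dvd_triv_right)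
    then show ?thesis
      using assms False by (simp add: coeff_reflect_poly degree_monom_eq coeff_pcompose_monom)
  qed
qed

text \<open>Reversal is multiplicative, and an involution on polynomials with nonzero constant term,
  so it carries factorisations both ways.\<close>

lemma irreducible_reflect_poly:
  fixes f :: "'a::idom poly"
  assumes irr: "irreducible f" and nz: "coeff f 0 \<noteq> 0"
  shows "irreducible (reflect_poly f)"
proof (rule irreducibleI)
  have unitI: "g dvd 1" if "reflect_poly g dvd 1" "coeff g 0 \<noteq> 0" for g :: "'a poly"
    using that by (metis dvd_def reflect_poly_1 reflect_poly_mult reflect_poly_reflect_poly)
  show "reflect_poly f \<noteq> 0" using irr by auto
  show "\<not> reflect_poly f dvd 1" using irr nz unitI[of f] by (auto simp: irreducible_def)
  fix g h
  assume gh: "reflect_poly f = g * h"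
  \<comment> \<open>The constant term of the reversal is the leading coefficient of f, so t divides
    neither factor and reversing twice restores both.\<close>
  then have "coeff g 0 * coeff h 0 = lead_coeff f"
    by (metis coeff_0_reflect_poly coeff_mult_0)
  then have nz_gh: "coeff g 0 \<noteq> 0" "coeff h 0 \<noteq> 0"
    using irr by auto
  have "f = reflect_poly g * reflect_poly h"
    using nz gh by (metis reflect_poly_mult reflect_poly_reflect_poly)
  then show "g dvd 1 \<or> h dvd 1"
    using irreducibleD[OF irr] unitI nz_gh by blast
qed

section \<open>Coordinates over R[s], s = t^k, in the basis 1, t, ..., t^(k-1)\<close>

text \<open>For i < k this is the coordinate q_i in q = sum of t^i q_i(t^k). The bound
  \<open>degree q\<close> is generous: for k > 0 no coefficient is lost.\<close>

definition residue_part :: "nat \<Rightarrow> nat \<Rightarrow> 'a::comm_semiring_1 poly \<Rightarrow> 'a poly" where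
  "residue_part k i q = (\<Sum>n\<le>degree q. monom (coeff q (n * k + i)) n)"

lemma coeff_residue_part:
  assumes "k > 0"
  shows "coeff (residue_part k i q) n = coeff q (n * k + i)"
proof (cases "n \<le> degree q")
  case False
  moreover have "n \<le> n * k" using assms by simp
  ultimately have "degree q < n * k + i" by linarith
  then show ?thesis using False by (simp add: residue_part_def coeff_sum coeff_eq_0)
qed (simp add: residue_part_def coeff_sum)

lemma residue_part_add:
  "k > 0 \<Longrightarrow> residue_part k i (p + q) = residue_part k i p + residue_part k i q"
  by (rule poly_eqI) (simp add: coeff_residue_part)

lemma residue_part_sum:
  "k > 0 \<Longrightarrow> residue_part k i (sum g A) = (\<Sum>x\<in>A. residue_part k i (g x))"
  by (rule poly_eqI) (simp add: coeff_residue_part coeff_sum)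

lemma residue_part_smult:
  "k > 0 \<Longrightarrow> residue_part k i (smult a q) = smult a (residue_part k i q)"
  by (rule poly_eqI) (simp add: coeff_residue_part)

lemma residue_part_monom_mult:
  assumes "i < k"
  shows "residue_part k i (monom 1 k * q) = pCons 0 (residue_part k i q)"
  using assms by (intro poly_eqI) (auto simp: coeff_residue_part coeff_monom_mult coeff_pCons split: nat.splits)

text \<open>Coordinates are R[s]-linear: multiplying by t^k shifts each coordinate by one degree,
  and induction on c does the rest.\<close>

lemma residue_part_mult_pcompose:
  assumes "i < k"
  shows "residue_part k i (q * pcompose c (monom 1 k)) = residue_part k i q * c"
proof (induction c)
  case 0
  have "k > 0" using assms by simp
  then have "residue_part k i 0 = 0" by (intro poly_eqI) (simp add: coeff_residue_part)
  then show ?case by simp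
next
  case (pCons a c)
  have "q * pcompose (pCons a c) (monom 1 k)
      = smult a q + monom 1 k * (q * pcompose c (monom 1 k))"
    by (simp add: pcompose_pCons algebra_simps)
  then show ?case
    using assms pCons.IH
    by (simp add: residue_part_add residue_part_smult residue_part_monom_mult)
qed

lemma residue_part_monom:
  assumes "i < k" "j < k"
  shows "residue_part k i (monom 1 j) = (if i = j then 1 else 0)"
proof (rule poly_eqI)
  fix n
  have "n * k + i = j \<longleftrightarrow> n = 0 \<and> i = j" using assms by (cases n) auto
  then show "coeff (residue_part k i (monom 1 j)) n = coeff (if i = j then 1 else 0 :: 'a poly) n"
    using assms by (auto simp: coeff_residue_part coeff_1)
qed

lemma sum_residue_part:
  assumes "k > 0"
  shows "(\<Sum>i<k. monom 1 i * pcompose (residue_part k i q) (monom 1 k)) = q"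
proof (rule poly_eqI)
  fix n
  have "coeff (monom 1 i * pcompose (residue_part k i q) (monom 1 k)) n
      = (if i = n mod k then coeff q n else 0)" if "i < k" for i
  proof (cases "i \<le> n \<and> k dvd n - i")
    case True
    then obtain m where "n = m * k + i" by (metis dvd_def le_add_diff_inverse2 mult.commute)
    then show ?thesis using that assms
      by (simp add: coeff_monom_mult coeff_pcompose_monom coeff_residue_part)
  next
    case False
    then have "i \<noteq> n mod k" by (metis mod_less_eq_dividend dvd_minus_mod)
    then show ?thesis using False assms
      by (auto simp: coeff_monom_mult coeff_pcompose_monom)
  qed
  then show "coeff (\<Sum>i<k. monom 1 i * pcompose (residue_part k i q) (monom 1 k)) n = coeff q n"
    using assms by (simp add: coeff_sum)
qed

section \<open>Multiplication matrices and the norm\<close>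

definition mult_mat :: "nat \<Rightarrow> 'a::comm_semiring_1 poly \<Rightarrow> 'a poly mat" where
  "mult_mat k q = mat k k (\<lambda>(i, j). residue_part k i (monom 1 j * q))"

lemma mult_mat_carrier [simp]: "mult_mat k q \<in> carrier_mat k k"
  by (simp add: mult_mat_def)

text \<open>Expand h in the basis; its coordinates then pass through as scalars. This is the entry
  formula behind \<open>mult_mat_mult\<close>.\<close>

lemma residue_part_mult:
  assumes "i < k"
  shows "residue_part k i (g * h) = (\<Sum>l<k. residue_part k i (monom 1 l * g) * residue_part k l h)"
proof -
  have k: "k > 0" using assms by simp
  have "g * h = (\<Sum>l<k. (monom 1 l * g) * pcompose (residue_part k l h) (monom 1 k))"
    by (subst sum_residue_part[OF k, of h, symmetric]) (simp add: sum_distrib_left algebra_simps)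
  then show ?thesis
    using assms k by (simp add: residue_part_sum residue_part_mult_pcompose)
qed

lemma mult_mat_mult: "mult_mat k (g * h) = mult_mat k g * mult_mat k h"
proof (rule eq_matI)
  fix i j
  assume "i < dim_row (mult_mat k g * mult_mat k h)" "j < dim_col (mult_mat k g * mult_mat k h)"
  then have ij: "i < k" "j < k" by (simp_all add: mult_mat_def)
  \<comment> \<open>Moving t^j onto h makes column j of the matrix of h appear.\<close>
  have "residue_part k i (monom 1 j * (g * h)) = residue_part k i (g * (monom 1 j * h))"
    by (simp add: algebra_simps)
  also have "\<dots> = (\<Sum>l<k. residue_part k i (monom 1 l * g) * residue_part k l (monom 1 j * h))"
    using ij by (intro residue_part_mult)
  finally show "mult_mat k (g * h) $$ (i, j) = (mult_mat k g * mult_mat k h) $$ (i, j)"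
    using ij by (simp add: mult_mat_def scalar_prod_def atLeast0LessThan)
qed (simp_all add: mult_mat_def)

text \<open>The norm of the free ring extension \<open>R[s] \<subseteq> R[t]\<close> with \<open>s = t\<^sup>k\<close>.\<close>

definition poly_norm :: "nat \<Rightarrow> 'a::comm_ring_1 poly \<Rightarrow> 'a poly" where
  "poly_norm k q = det (mult_mat k q)"

lemma poly_norm_mult: "poly_norm k (g * h) = poly_norm k g * poly_norm k h"
  unfolding poly_norm_def mult_mat_mult by (rule det_mult) (rule mult_mat_carrier)+

text \<open>f(t^k) acts on R[t] as the scalar f(s).\<close>

lemma poly_norm_pcompose: "poly_norm k (pcompose f (monom 1 k)) = f ^ k"
proof -
  have "mult_mat k (pcompose f (monom 1 k)) = f \<cdot>\<^sub>m 1\<^sub>m k"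
    by (rule eq_matI) (auto simp: mult_mat_def residue_part_mult_pcompose residue_part_monom)
  then show ?thesis by (simp add: poly_norm_def)
qed

text \<open>Putting s = 0 commutes with the determinant. Since t^j q has no terms below t^j, the
  matrix becomes lower triangular with q(0) along the diagonal.\<close>

lemma coeff_0_poly_norm: "coeff (poly_norm k q) 0 = coeff q 0 ^ k"
proof -
  let ?A = "map_mat (\<lambda>p. poly p 0) (mult_mat k q)"
  have entry: "?A $$ (i, j) = (if j \<le> i then coeff q (i - j) else 0)" if "i < k" "j < k" for i j
    using that by (simp add: mult_mat_def poly_0_coeff_0 coeff_residue_part coeff_monom_mult)
  have "coeff (poly_norm k q) 0 = det ?A"
    by (simp only: poly_norm_def poly_0_coeff_0[symmetric]
        comm_ring_hom.hom_det[OF poly_hom.comm_ring_hom_axioms])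
  also have "\<dots> = prod_list (diag_mat ?A)"
    by (rule det_lower_triangular[of k]) (use entry in auto)
  also have "diag_mat ?A = replicate k (coeff q 0)"
    using entry by (intro nth_equalityI) (auto simp: diag_mat_def mult_mat_def)
  finally show ?thesis by simp
qed

text \<open>The cofactor is read off the first column of the adjugate matrix.\<close>

lemma dvd_pcompose_poly_norm:
  assumes "k > 0"
  shows "q dvd pcompose (poly_norm k q) (monom 1 k)"
proof -
  define v where "v l = adj_mat (mult_mat k q) $$ (l, 0)" for l
  define b where "b = (\<Sum>l<k. monom 1 l * pcompose (v l) (monom 1 k))"
  have adj: "adj_mat (mult_mat k q) \<in> carrier_mat k k"
    "mult_mat k q * adj_mat (mult_mat k q) = poly_norm k q \<cdot>\<^sub>m 1\<^sub>m k"
    unfolding poly_norm_def by (rule adj_mat[OF mult_mat_carrier])+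
  \<comment> \<open>The coordinates of q b are the matrix times column 0 of its adjugate, that is,
    the norm times the first basis vector.\<close>
  have "residue_part k i (q * b) = (if i = 0 then poly_norm k q else 0)" if i: "i < k" for i
  proof -
    have "q * b = (\<Sum>l<k. (monom 1 l * q) * pcompose (v l) (monom 1 k))"
      by (simp add: b_def sum_distrib_left algebra_simps)
    then have "residue_part k i (q * b) = (\<Sum>l<k. residue_part k i (monom 1 l * q) * v l)"
      using i by (simp add: residue_part_sum residue_part_mult_pcompose)
    also have "\<dots> = (mult_mat k q * adj_mat (mult_mat k q)) $$ (i, 0)"
      using i adj(1) by (simp add: mult_mat_def v_def scalar_prod_def atLeast0LessThan)
    also have "\<dots> = (if i = 0 then poly_norm k q else 0)"
      using i unfolding adj(2) by simp
    finally show ?thesis .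
  qed
  then have "q * b = (\<Sum>i<k. monom 1 i * pcompose (if i = 0 then poly_norm k q else 0) (monom 1 k))"
    using sum_residue_part[OF assms, of "q * b"] by simp
  also have "\<dots> = (\<Sum>i<k. if i = 0 then pcompose (poly_norm k q) (monom 1 k) else 0)"
    by (rule sum.cong) simp_all
  also have "\<dots> = pcompose (poly_norm k q) (monom 1 k)"
    using assms by simp
  finally show ?thesis by (metis dvd_triv_left)
qed

section \<open>Irreducibility of f(t^k) over a domain\<close>

lemma coeff_0_dvd: "p dvd q \<Longrightarrow> coeff p 0 dvd coeff q 0"
  by (auto simp: dvd_def coeff_mult_0)

text \<open>Each factor f of the power must divide b and can be cancelled there, until a c = 1
  remains; so the induction has to vary b.\<close>

lemma prime_elem_mult_eq_power_imp_unit: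
  fixes f :: "'a::idom_divide"
  assumes "prime_elem f" "a * b = f ^ n" "\<not> f dvd a"
  shows "a dvd 1"
  using assms(2)
proof (induction n arbitrary: b)
  case 0
  then show ?case by (metis dvd_triv_left power_0)
next
  case (Suc n)
  then have "f dvd b"
    using assms(1,3) by (metis dvd_triv_left power_Suc prime_elem_dvd_multD)
  then obtain c where "b = f * c" ..
  with Suc.prems have "f * (a * c) = f * f ^ n" by (simp add: ac_simps)
  then show ?case using assms(1) Suc.IH by auto
qed

text \<open>Primality of f drives the cancellation in f^k; over the integers it will follow from
  irreducibility by unique factorisation.\<close>

lemma irreducible_pcompose_monom:
  fixes f :: "'a::idom_divide poly"
  assumes f: "prime_elem f" and p: "prime_elem p"
    and p_dvd: "p dvd coeff f 0" and p2: "\<not> p\<^sup>2 dvd coeff f 0" and k: "k > 0"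
  shows "irreducible (pcompose f (monom 1 k))"
proof (rule irreducibleI)
  have const: "coeff (pcompose f (monom 1 k)) 0 = coeff f 0"
    using k by (subst coeff_pcompose_monom) simp_all
  \<comment> \<open>A zero constant term would be divisible by \<open>p\<^sup>2\<close>.\<close>
  show "pcompose f (monom 1 k) \<noteq> 0"
    using p2 const by (metis coeff_0 dvd_0_right)
  have unitI: "h dvd 1" if gh: "h * g = pcompose f (monom 1 k)" and h: "\<not> p dvd coeff h 0" for g h
  proof -
    have not_dvd: "\<not> f dvd poly_norm k h"
    proof
      assume "f dvd poly_norm k h"
      then have "coeff f 0 dvd coeff (poly_norm k h) 0"
        by (rule coeff_0_dvd)
      with p_dvd have "p dvd coeff h 0 ^ k"
        unfolding coeff_0_poly_norm by (rule dvd_trans)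
      with prime_elem_dvd_power[OF p] h show False by blast
    qed
    have "poly_norm k h * poly_norm k g = f ^ k"
      by (simp add: gh poly_norm_pcompose flip: poly_norm_mult)
    from prime_elem_mult_eq_power_imp_unit[OF f this not_dvd]
    obtain u where "1 = poly_norm k h * u" ..
    \<comment> \<open>Substitution is a ring homomorphism, so it sends the unit
      \<open>poly_norm k h\<close> to a unit, which h divides.\<close>
    then have "1 = pcompose (poly_norm k h) (monom 1 k) * pcompose u (monom 1 k)"
      by (simp flip: pcompose_mult)
    then have "pcompose (poly_norm k h) (monom 1 k) dvd 1" ..
    with dvd_pcompose_poly_norm[OF k] show ?thesis
      by (rule dvd_trans)
  qed
  show "\<not> pcompose f (monom 1 k) dvd 1"
  proof
    assume "pcompose f (monom 1 k) dvd 1"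
    then have "coeff f 0 dvd 1"
      by (metis coeff_0_dvd const coeff_1 of_bool_eq(2))
    with p_dvd have "p dvd 1" by (rule dvd_trans)
    with p show False by (simp add: prime_elem_def)
  qed
  fix g h
  assume gh: "pcompose f (monom 1 k) = g * h"
  \<comment> \<open>Otherwise \<open>p\<^sup>2\<close> would divide g(0) h(0) = f(0).\<close>
  have "\<not> p dvd coeff g 0 \<or> \<not> p dvd coeff h 0"
    using p2 mult_dvd_mono by (auto simp: gh coeff_mult_0 power2_eq_square simp flip: const)
  then show "g dvd 1 \<or> h dvd 1"
    using unitI[of h g] unitI[of g h] gh by (auto simp: mult.commute)
qed

section \<open>Gauss's lemma and the theorem over the rationals\<close>

lemma irreducible_of_int_poly_iff:
  fixes f :: "int poly"
  assumes f: "content f = 1" "degree f > 0"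
  shows "irreducible (map_poly rat_of_int f) \<longleftrightarrow> irreducible f"
proof
  assume irr: "irreducible (map_poly rat_of_int f)"
  show "irreducible f"
  proof (rule irreducibleI)
    show "f \<noteq> 0" using f by auto
    show "\<not> f dvd 1" using f by (auto simp: poly_dvd_1)
    fix g h
    assume gh: "f = g * h"
    \<comment> \<open>A factor that becomes a unit over the rationals is a constant, and a constant
      dividing f divides its content 1.\<close>
    have unitI: "u dvd 1" if "u dvd f" "map_poly rat_of_int u dvd 1" for u
    proof -
      from that(2) have "degree u = 0" by (simp add: poly_dvd_1)
      then obtain c where u: "u = [:c:]" by (auto dest: degree0_coeffs)
      with that(1) have "c dvd content f" by (simp add: const_poly_dvd_iff_dvd_content)
      with f(1) u show ?thesis by (simp add: is_unit_const_poly_iff)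
    qed
    have "map_poly rat_of_int f = map_poly rat_of_int g * map_poly rat_of_int h"
      by (simp add: gh of_int_poly_hom.hom_mult)
    then have "map_poly rat_of_int g dvd 1 \<or> map_poly rat_of_int h dvd 1"
      by (rule irreducibleD[OF irr])
    then show "g dvd 1 \<or> h dvd 1"
      using unitI gh by auto
  qed
next
  assume "irreducible f"
  \<comment> \<open>\<open>irreducible\<^sub>d\<close> only rules out factors of smaller degree; for
    primitive polynomials it agrees with irreducibility, and it transfers to the rationals.\<close>
  then have "irreducible\<^sub>d f" using f(1) irreducible_primitive_connect[of f] by simp
  then show "irreducible (map_poly rat_of_int f)"
    using irreducible\<^sub>d_int_rat by simp
qed

theorem corollary4p2:
  fixes f :: "int poly" and d :: nat
  assumes "degree f = d"
    and "irreducible (map_poly of_int f :: rat poly)"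
    and "content f = 1"
    and "\<exists>p::int. prime p \<and>
           (divides_exactly_once p (coeff f d) \<or> divides_exactly_once p (coeff f 0))"
  shows "strongly_irreducible (map_poly of_int f)"
  unfolding strongly_irreducible_def
proof (intro allI impI)
  fix k :: nat
  assume k: "k > 0"
  let ?F = "pcompose f (monom 1 k)"
  have nonconst: "degree f > 0"
  proof (rule ccontr)
    assume "\<not> degree f > 0"
    then have "degree (map_poly rat_of_int f) = 0" by simp
    with assms(2) show False
      by (auto simp: irreducible_def poly_dvd_1 dvd_field_iff elim!: degree_eq_zeroE)
  qed
  then have irr: "irreducible f"
    using assms(2,3) irreducible_of_int_poly_iff by blast
  obtain p :: int where p: "prime p"
    and p_cases: "divides_exactly_once p (coeff f d) \<or> divides_exactly_once p (coeff f 0)"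
    using assms(4) by blast
  have "irreducible ?F"
  proof (cases "divides_exactly_once p (coeff f 0)")
    case True
    then show ?thesis
      using irr p k
      by (intro irreducible_pcompose_monom[of f p] irreducible_imp_prime_poly)
        (auto simp: divides_exactly_once_def)
  next
    case False
    with p_cases have lead: "divides_exactly_once p (lead_coeff f)"
      using assms(1) by simp
    show ?thesis
    \<comment> \<open>Reversal needs f(0) nonzero. If f(0) = 0, then f is t times a unit, so p would
      divide a unit leading coefficient.\<close>
    proof (cases "coeff f 0 = 0")
      case True
      then obtain g where g: "f = [:0, 1:] * g"
        by (metis dvd_def poly_eq_0_iff_dvd poly_0_coeff_0 minus_zero)
      moreover have "\<not> [:0, 1:] dvd (1 :: int poly)" by (simp add: poly_dvd_1)
      ultimately have "g dvd 1" using irreducibleD[OF irr g] by blast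
      then have "lead_coeff f dvd 1"
        unfolding g lead_coeff_mult by (auto simp: poly_dvd_1)
      with lead p show ?thesis
        by (meson divides_exactly_once_def dvd_trans not_prime_unit)
    next
      case nz: False
      \<comment> \<open>The reversed polynomial has the leading coefficient of f as constant term;
        reversal commutes with substitution, so the result can be reversed back.\<close>
      have "irreducible (pcompose (reflect_poly f) (monom 1 k))"
        using irr nz p k lead
        by (intro irreducible_pcompose_monom[of _ p] irreducible_imp_prime_poly)
          (auto simp: divides_exactly_once_def irreducible_reflect_poly)
      then have "irreducible (reflect_poly ?F)"
        using k by (simp add: reflect_poly_pcompose_monom)
      moreover have "coeff ?F 0 \<noteq> 0"
        using nz k by (simp add: poly_0_coeff_0)
      moreover from this have "coeff (reflect_poly ?F) 0 \<noteq> 0"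
        by (metis coeff_0 coeff_0_reflect_poly_0_iff)
      ultimately show ?thesis
        by (metis irreducible_reflect_poly reflect_poly_reflect_poly)
    qed
  qed
  moreover have "degree ?F > 0"
    using nonconst k by (simp add: degree_pcompose degree_monom_eq)
  \<comment> \<open>An irreducible integer polynomial of positive degree is primitive, so Gauss's
    lemma applies to \<open>?F\<close>.\<close>
  ultimately have "irreducible (map_poly rat_of_int ?F)"
    using irreducible_of_int_poly_iff irreducible_imp_primitive by force
  also have "map_poly rat_of_int ?F = pcompose (map_poly of_int f) (monom 1 k)"
    using k by (intro poly_eqI) (simp add: coeff_pcompose_monom)
  finally show "irreducible (pcompose (map_poly rat_of_int f) (monom 1 k))" .
qed

end
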